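(* Let $\mathcal{A}$ be a unital $C^*$-algebra, let $\mathcal{F}\subseteq\mathcal{A}$ be an ideal of finite type elements, and let $a\in\mathcal{A}$. Then $a$ is an upper semi-Fredholm element if and only if $a$ is left invertible up to some projection $p\in\mathcal{F}$. Similarly, $a$ is a lower semi-Fredholm element if and only if $a$ is right invertible up to some projection $q\in\mathcal{F}$.
   Context: Ideal of finite type elements: a subalgebra $\mathcal{F}\subseteq\mathcal{A}$ such that (i) $\mathcal{F}$ is a selfadjoint ideal: $ab,ba\in\mathcal{F}$ for all $a\in\mathcal{A}$, $b\in\mathcal{F}$, and $a\in\mathcal{F}$ implies $a^*\in\mathcal{F}$; (ii) there is an approximate unit $(p_\alpha)$ (in the norm topology) for $\mathcal{F}$ consisting of projections; (iii) if $p,q\in\mathcal{F}$ are projections, then there exists $v\in\mathcal{A}$ such that $vv^*=q$ and $v^*v\perp p$, i.e. $v^*v+p$ is a projection. For $a\in\mathcal{A}$ and projections $p,q\in\mathcal{A}$, $a$ is invertible up to the pair $(p,q)$ if, with $a'=(1-q)a(1-p)$, there is $b\in\mathcal{A}$ with $b=(1-p)b(1-q)$, $a'b=1-q$, $ba'=1-p$. The element $a$ is left invertible up to a projection $p$ if there is $b\in\mathcal{A}$ with $ba(1-p)=1-p$; it is right invertible up to a projection $q$ if there is $b\in\mathcal{A}$ with $(1-q)ab=1-q$. $a$ is an upper (resp. lower) semi-Fredholm element with respect to $\mathcal{F}$ if $a$ is invertible up to some pair $(p,q)$ of projections in $\mathcal{A}$ with $p\in\mathcal{F}$ (resp. $q\in\mathcal{F}$).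 *)

theory Defs
  imports "HOL-Analysis.Analysis"
begin

text \<open>
  A unital complex \<open>C\<^sup>*\<close>-algebra is modelled as a type. The unit comes from
  \<open>monoid_mult\<close> rather than \<open>ring_1\<close>, so that \<open>0 = 1\<close> (the zero algebra) is not excluded.
\<close>

class cstar_algebra = real_normed_algebra + complete_space + monoid_mult +
  fixes scaleC :: "complex \<Rightarrow> 'a \<Rightarrow> 'a" (infixr \<open>*\<^sub>C\<close> 75)
    and star :: "'a \<Rightarrow> 'a" (\<open>(_\<^sup>\<star>)\<close> [1000] 999)
  assumes scaleC_of_real: "complex_of_real r *\<^sub>C x = r *\<^sub>R x"
    and scaleC_add_right: "c *\<^sub>C (x + y) = c *\<^sub>C x + c *\<^sub>C y"
    and scaleC_add_left: "(c + d) *\<^sub>C x = c *\<^sub>C x + d *\<^sub>C x"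
    and scaleC_scaleC: "c *\<^sub>C d *\<^sub>C x = (c * d) *\<^sub>C x"
    and mult_scaleC_left: "(c *\<^sub>C x) * y = c *\<^sub>C (x * y)"
    and mult_scaleC_right: "x * (c *\<^sub>C y) = c *\<^sub>C (x * y)"
    and norm_scaleC: "norm (c *\<^sub>C x) = cmod c * norm x"
    and star_star: "(x\<^sup>\<star>)\<^sup>\<star> = x"
    and star_add: "(x + y)\<^sup>\<star> = x\<^sup>\<star> + y\<^sup>\<star>"
    and star_mult: "(x * y)\<^sup>\<star> = y\<^sup>\<star> * x\<^sup>\<star>"
    and star_scaleC: "(c *\<^sub>C x)\<^sup>\<star> = cnj c *\<^sub>C x\<^sup>\<star>"
    and cstar_identity: "norm (x\<^sup>\<star> * x) = (norm x)\<^sup>2"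

instantiation complex :: cstar_algebra
begin

definition scaleC_complex :: "complex \<Rightarrow> complex \<Rightarrow> complex"
  where "scaleC_complex c x = c * x"

definition star_complex :: "complex \<Rightarrow> complex"
  where "star_complex x = cnj x"

instance
  by standard
    (auto simp: scaleC_complex_def star_complex_def scaleR_conv_of_real algebra_simps
      norm_mult power2_eq_square)

end

definition is_projection :: "'a::cstar_algebra \<Rightarrow> bool"
  where "is_projection p \<longleftrightarrow> p * p = p \<and> p\<^sup>\<star> = p"

definition subalgebra :: "'a::cstar_algebra set \<Rightarrow> bool"
  where "subalgebra F \<longleftrightarrow>
    0 \<in> F \<and>
    (\<forall>x\<in>F. \<forall>y\<in>F. x + y \<in> F) \<and>
    (\<forall>c. \<forall>x\<in>F. c *\<^sub>C x \<in> F) \<and>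
    (\<forall>x\<in>F. \<forall>y\<in>F. x * y \<in> F)"

definition selfadjoint_ideal :: "'a::cstar_algebra set \<Rightarrow> bool"
  where "selfadjoint_ideal F \<longleftrightarrow>
    (\<forall>a. \<forall>b\<in>F. a * b \<in> F \<and> b * a \<in> F) \<and> (\<forall>a\<in>F. a\<^sup>\<star> \<in> F)"

definition directed_set :: "'i set \<Rightarrow> ('i \<Rightarrow> 'i \<Rightarrow> bool) \<Rightarrow> bool"
  where "directed_set I le \<longleftrightarrow>
    I \<noteq> {} \<and>
    (\<forall>i\<in>I. le i i) \<and>
    (\<forall>i\<in>I. \<forall>j\<in>I. \<forall>k\<in>I. le i j \<longrightarrow> le j k \<longrightarrow> le i k) \<and>
    (\<forall>i\<in>I. \<forall>j\<in>I. \<exists>k\<in>I. le i k \<and> le j k)"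

definition net_tendsto ::
  "'i set \<Rightarrow> ('i \<Rightarrow> 'i \<Rightarrow> bool) \<Rightarrow> ('i \<Rightarrow> 'a::real_normed_vector) \<Rightarrow> 'a \<Rightarrow> bool"
  where "net_tendsto I le x l \<longleftrightarrow>
    (\<forall>e>0. \<exists>i\<in>I. \<forall>j\<in>I. le i j \<longrightarrow> norm (x j - l) < e)"

text \<open>The net is not required to be increasing.\<close>

definition projection_approximate_unit ::
  "'a::cstar_algebra set \<Rightarrow> 'i set \<Rightarrow> ('i \<Rightarrow> 'i \<Rightarrow> bool) \<Rightarrow> ('i \<Rightarrow> 'a) \<Rightarrow> bool"
  where "projection_approximate_unit F I le p \<longleftrightarrow>
    directed_set I le \<and>
    (\<forall>i\<in>I. p i \<in> F \<and> is_projection (p i)) \<and>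
    (\<forall>b\<in>F. net_tendsto I le (\<lambda>i. p i * b) b \<and> net_tendsto I le (\<lambda>i. b * p i) b)"

text \<open>
  The type \<open>'i\<close> supplies the indices of the approximate unit. A definition cannot quantify over
  types, so \<open>'i\<close> is an argument; in a theorem that assumes \<open>finite_type_ideal TYPE('i) F\<close> it is
  an arbitrary type, hence nets over arbitrary directed sets are covered.
\<close>

definition finite_type_ideal :: "'i itself \<Rightarrow> 'a::cstar_algebra set \<Rightarrow> bool"
  where "finite_type_ideal _ F \<longleftrightarrow>
    subalgebra F \<and>
    selfadjoint_ideal F \<and>
    (\<exists>(I :: 'i set) le p. projection_approximate_unit F I le p) \<and>
    (\<forall>p\<in>F. \<forall>q\<in>F. is_projection p \<longrightarrow> is_projection q \<longrightarrow>
      (\<exists>v. v * v\<^sup>\<star> = q \<and> is_projection (v\<^sup>\<star> * v + p)))"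

definition invertible_up_to :: "'a::cstar_algebra \<Rightarrow> 'a \<Rightarrow> 'a \<Rightarrow> bool"
  where "invertible_up_to a p q \<longleftrightarrow>
    (let a' = (1 - q) * a * (1 - p)
     in \<exists>b. b = (1 - p) * b * (1 - q) \<and> a' * b = 1 - q \<and> b * a' = 1 - p)"

definition left_invertible_up_to :: "'a::cstar_algebra \<Rightarrow> 'a \<Rightarrow> bool"
  where "left_invertible_up_to a p \<longleftrightarrow> (\<exists>b. b * a * (1 - p) = 1 - p)"

definition right_invertible_up_to :: "'a::cstar_algebra \<Rightarrow> 'a \<Rightarrow> bool"
  where "right_invertible_up_to a q \<longleftrightarrow> (\<exists>b. (1 - q) * a * b = 1 - q)"

definition upper_semi_fredholm :: "'a::cstar_algebra set \<Rightarrow> 'a \<Rightarrow> bool"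
  where "upper_semi_fredholm F a \<longleftrightarrow>
    (\<exists>p q. is_projection p \<and> is_projection q \<and> p \<in> F \<and> invertible_up_to a p q)"

definition lower_semi_fredholm :: "'a::cstar_algebra set \<Rightarrow> 'a \<Rightarrow> bool"
  where "lower_semi_fredholm F a \<longleftrightarrow>
    (\<exists>p q. is_projection p \<and> is_projection q \<and> q \<in> F \<and> invertible_up_to a p q)"

end

theory Submission
  imports Defs
begin

text \<open>
  If \<open>c * a * (1 - p) = 1 - p\<close>, then \<open>e = a * (1 - p) * c\<close> may be taken idempotent, and \<open>1 - q\<close>
  is the range projection of \<open>e\<close>. By Kaplansky's formula this is \<open>e * e\<^sup>\<star> * z\<^sup>-\<^sup>1\<close> with
  \<open>z = 1 - (e - e\<^sup>\<star>)\<^sup>2\<close>, which commutes with \<open>e\<close> and \<open>e\<^sup>\<star>\<close>. The element \<open>z\<close> is invertible because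
  \<open>z = (1 - y) * (1 + y)\<close> for the skew-adjoint \<open>y = e - e\<^sup>\<star>\<close>, and \<open>-1\<close> is not in the spectrum
  of a skew-adjoint element. The lower case follows from the upper one by passing to adjoints.
\<close>

subclass (in cstar_algebra) banach ..

lemma star_one [simp]: "(1::'a::cstar_algebra)\<^sup>\<star> = 1"
  by (metis mult_1_right star_mult star_star)

lemma star_diff: "(x - y)\<^sup>\<star> = x\<^sup>\<star> - (y::'a::cstar_algebra)\<^sup>\<star>"
  by (metis add_diff_cancel_right' diff_add_cancel star_add)

lemma star_zero [simp]: "(0::'a::cstar_algebra)\<^sup>\<star> = 0"
  using star_diff[of "0::'a" 0] by simp

lemma star_minus: "(- x)\<^sup>\<star> = - (x::'a::cstar_algebra)\<^sup>\<star>"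
  using star_diff[of 0 x] by simp

lemma star_scaleR: "(r *\<^sub>R x)\<^sup>\<star> = r *\<^sub>R (x::'a::cstar_algebra)\<^sup>\<star>"
  by (metis complex_cnj_complex_of_real scaleC_of_real star_scaleC)

text \<open>The C*-identity makes the norm of \<open>1\<close> a root of t = t^2. An inequality is
  claimed because that norm is 0 in the zero algebra.\<close>

lemma norm_one_le: "norm (1::'a::cstar_algebra) \<le> 1"
proof -
  have "norm (1::'a) = (norm (1::'a))\<^sup>2"
    using cstar_identity[of "1::'a"] by simp
  then show ?thesis
    by (metis order.refl mult_cancel_left1 power2_eq_square zero_le_one)
qed

lemma norm_power_le:
  fixes x :: "'a::cstar_algebra"
  shows "norm (x ^ n) \<le> norm x ^ n"
proof (induction n)
  case 0
  show ?case by (simp add: norm_one_le)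
next
  case (Suc n)
  have "norm (x ^ Suc n) \<le> norm x * norm (x ^ n)"
    by (simp add: norm_mult_ineq)
  also have "\<dots> \<le> norm x * norm x ^ n"
    by (intro mult_left_mono Suc) simp
  finally show ?case by simp
qed

text \<open>Neumann series: multiplying the sum of the powers of \<open>x\<close> by
  \<open>x\<close> on either side drops its first term.\<close>

lemma one_minus_invertible:
  fixes x :: "'a::cstar_algebra"
  assumes "norm x < 1"
  shows "\<exists>s. (1 - x) * s = 1 \<and> s * (1 - x) = 1"
proof -
  have sm: "summable (\<lambda>n. x ^ n)"
    by (rule summable_comparison_test[where g = "\<lambda>n. norm x ^ n"])
      (use assms in \<open>auto simp: norm_power_le intro: summable_geometric\<close>)
  define s where "s = (\<Sum>n. x ^ n)"
  have tail: "(\<Sum>n. x ^ Suc n) = s - 1"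
    using suminf_split_head[OF sm] by (simp add: s_def)
  have "x * s = s - 1"
    using tail suminf_mult[OF sm, of x] by (simp add: s_def)
  moreover have "s * x = s - 1"
    using tail suminf_mult2[OF sm, of x] by (simp add: s_def power_commutes)
  ultimately show ?thesis
    by (intro exI[of _ s]) (simp add: algebra_simps)
qed

lemma one_plus_skew_invertible:
  fixes y :: "'a::cstar_algebra"
  assumes skew: "y\<^sup>\<star> = - y"
  shows "\<exists>s. (1 + y) * s = 1 \<and> s * (1 + y) = 1"
proof -
  \<comment> \<open>Arens' trick: the shift \<open>n - y\<close> has norm less than \<open>n + 1\<close> for large \<open>n\<close>.\<close>
  define n where "n = (norm y)\<^sup>2"
  have n0: "n \<ge> 0" by (simp add: n_def)
  define u where "u = n *\<^sub>R 1 - y"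
  have "u\<^sup>\<star> * u = n\<^sup>2 *\<^sub>R 1 - y * y"
    by (simp add: u_def star_diff star_scaleR skew algebra_simps power2_eq_square)
  then have "(norm u)\<^sup>2 = norm (n\<^sup>2 *\<^sub>R 1 - y * y)"
    by (metis cstar_identity)
  also have "\<dots> \<le> norm (n\<^sup>2 *\<^sub>R (1::'a)) + norm (y * y)"
    by (rule norm_triangle_ineq4)
  \<comment> \<open>The choice of \<open>n\<close> as the square of \<open>norm y\<close> bounds
    \<open>norm (y * y)\<close> by \<open>n\<close>, which keeps the total below n^2 + 2n +
    1.\<close>
  also have "\<dots> \<le> n\<^sup>2 + n"
  proof (rule add_mono)
    show "norm (n\<^sup>2 *\<^sub>R (1::'a)) \<le> n\<^sup>2"
      using mult_left_mono[OF norm_one_le, of "n\<^sup>2"] by simp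
    show "norm (y * y) \<le> n"
      using norm_mult_ineq[of y y] by (simp add: n_def power2_eq_square)
  qed
  also have "\<dots> < (n + 1)\<^sup>2"
    using n0 by (simp add: power2_eq_square algebra_simps)
  finally have un: "norm u < n + 1"
    using n0 by (simp add: power2_less_imp_less)
  \<comment> \<open>Since (n + 1) - u = 1 + y, this scaling turns \<open>1 + y\<close> into a
    multiple of \<open>1 - x\<close>.\<close>
  define x where "x = inverse (n + 1) *\<^sub>R u"
  have "norm x < 1"
    using un n0 by (simp add: x_def field_simps)
  then obtain s where s: "(1 - x) * s = 1" "s * (1 - x) = 1"
    using one_minus_invertible by blast
  have "(n + 1) *\<^sub>R x = u"
    using n0 by (simp add: x_def)
  then have "1 + y = (n + 1) *\<^sub>R (1 - x)"
    by (simp add: u_def scaleR_diff_right scaleR_add_left)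
  then show ?thesis
    using s n0 by (intro exI[of _ "inverse (n + 1) *\<^sub>R s"]) simp
qed

text \<open>The two equations on \<open>r\<close> and \<open>e\<close> say that they generate the
  same right ideal.\<close>

lemma idempotent_range_projection:
  fixes e :: "'a::cstar_algebra"
  assumes ee: "e * e = e"
  shows "\<exists>r. is_projection r \<and> r * e = e \<and> e * r = r"
proof -
  define f where "f = e\<^sup>\<star>"
  have ff: "f * f = f"
    by (metis ee f_def star_mult)
  have fs: "f\<^sup>\<star> = e" "e\<^sup>\<star> = f"
    by (simp_all add: f_def star_star)
  define y where "y = e - f"
  \<comment> \<open>This is \<open>1 - y * y\<close> expanded with the idempotence of
    \<open>e\<close> and \<open>f\<close>.\<close>
  define z where "z = 1 - e - f + e * f + f * e"
  have skew: "y\<^sup>\<star> = - y"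
    by (simp add: y_def star_diff fs)
  obtain s where s: "(1 + y) * s = 1" "s * (1 + y) = 1"
    using one_plus_skew_invertible[OF skew] by blast
  obtain t where t: "(1 - y) * t = 1" "t * (1 - y) = 1"
    using one_plus_skew_invertible[of "- y"] skew by (auto simp: star_minus)
  define w where "w = s * t"
  have z1: "z = (1 - y) * (1 + y)"
    by (simp add: z_def y_def algebra_simps ee ff)
  have zw: "z * w = 1" and wz: "w * z = 1"
    unfolding z1 w_def by (metis mult.assoc mult_1_left mult_1_right s t)+
  have zs: "z\<^sup>\<star> = z"
    by (simp add: z_def star_add star_diff star_mult fs)
  have ws: "w\<^sup>\<star> = w"
    by (metis mult.assoc mult_1_left mult_1_right star_mult star_one wz zs zw)
  have eez: "e * (e * x) = e * x" and ffz: "f * (f * x) = f * x" for x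
    by (simp_all add: mult.assoc[symmetric] ee ff)
  \<comment> \<open>Products with \<open>z\<close> from the left and from the right collapse to the
    same element, so \<open>z\<close>, and with it the inverse \<open>w\<close>, commutes with
    \<open>e\<close> and \<open>f\<close>.\<close>
  have ez: "e * z = e * f * e" "z * e = e * f * e"
    and fz: "f * z = f * e * f" "z * f = f * e * f"
    by (simp_all add: z_def algebra_simps ee ff eez ffz)
  have ew: "e * w = w * e" and fw: "f * w = w * f"
    by (metis ez mult.assoc mult_1_left mult_1_right wz zw)
      (metis fz mult.assoc mult_1_left mult_1_right wz zw)
  define r where "r = e * f * w"
  \<comment> \<open>Moving \<open>w\<close> past \<open>e\<close> gives
    \<open>r * e = e * f * e * w = e * z * w\<close>.\<close>
  have re: "r * e = e"
    by (metis ew ez(1) mult.assoc mult_1_right r_def zw)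
  have er: "e * r = r"
    by (simp add: r_def eez mult.assoc)
  have "r * r = r"
    by (metis re mult.assoc r_def)
  moreover have "r\<^sup>\<star> = r"
    by (metis ew fw fs mult.assoc r_def star_mult ws)
  ultimately show ?thesis
    using re er unfolding is_projection_def by blast
qed

lemma is_projection_one_minus:
  "is_projection p \<Longrightarrow> is_projection (1 - p)"
  by (simp add: is_projection_def star_diff algebra_simps)

lemma invertible_up_to_imp_left_invertible_up_to:
  assumes "invertible_up_to a p q"
  shows "left_invertible_up_to a p"
proof -
  obtain b where "b * ((1 - q) * a * (1 - p)) = 1 - p"
    using assms by (auto simp: invertible_up_to_def Let_def)
  then show ?thesis
    unfolding left_invertible_up_to_def
    by (intro exI[of _ "b * (1 - q)"]) (simp add: mult.assoc)
qed

lemma left_invertible_up_to_imp_invertible_up_to: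
  assumes "is_projection p" and "left_invertible_up_to a p"
  shows "\<exists>q. is_projection q \<and> invertible_up_to a p q"
proof -
  obtain c0 where c0: "c0 * a * (1 - p) = 1 - p"
    using assms(2) by (auto simp: left_invertible_up_to_def)
  define k where "k = 1 - p"
  have kk: "k * k = k"
    using is_projection_one_minus[OF assms(1)] by (simp add: k_def is_projection_def)
  \<comment> \<open>Compressing by \<open>k\<close> gives \<open>k * c = c\<close>. Together with
    \<open>c * x = k\<close> this makes \<open>x * c\<close> idempotent.\<close>
  define c where "c = k * c0"
  define x where "x = a * k"
  have cx: "c * x = k"
    using c0 kk by (simp add: c_def x_def k_def mult.assoc)
  have kc: "k * c = c" and xk: "x * k = x"
    by (metis c_def kk mult.assoc) (metis x_def kk mult.assoc)
  have "x * c * (x * c) = x * c"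
    by (metis cx kc mult.assoc)
  then obtain r where r: "is_projection r" "r * (x * c) = x * c" "x * c * r = r"
    using idempotent_range_projection by blast
  \<comment> \<open>Here \<open>x = x * k = x * c * x\<close>, and \<open>r\<close> fixes
    \<open>x * c\<close>.\<close>
  have rx: "r * x = x"
    by (metis cx mult.assoc r(2) xk)
  have rr: "r * r = r"
    using r(1) by (simp add: is_projection_def)
  \<comment> \<open>The witness is \<open>c * r\<close> with \<open>q = 1 - r\<close>. As
    \<open>r * x = x\<close>, the compression \<open>r * a * k\<close> is just
    \<open>x\<close>.\<close>
  have "c * r = k * (c * r) * r"
    by (metis kc rr mult.assoc)
  moreover have "r * a * k * (c * r) = r"
    using r(3) rx by (metis mult.assoc x_def)
  moreover have "c * r * (r * a * k) = k"
    using cx rx by (metis mult.assoc x_def)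
  ultimately have "invertible_up_to a p (1 - r)"
    unfolding invertible_up_to_def Let_def k_def by auto
  then show ?thesis
    using is_projection_one_minus[OF r(1)] by blast
qed

lemma upper_semi_fredholm_iff_left_invertible:
  "upper_semi_fredholm F a \<longleftrightarrow> (\<exists>p\<in>F. is_projection p \<and> left_invertible_up_to a p)"
  unfolding upper_semi_fredholm_def
  using invertible_up_to_imp_left_invertible_up_to left_invertible_up_to_imp_invertible_up_to
  by blast

text \<open>The adjoint of the inverse \<open>b\<close> is the new inverse. Taking adjoints reverses
  products, so the left and right inverse equations trade places along with \<open>p\<close> and
  \<open>q\<close>.\<close>

lemma invertible_up_to_star:
  assumes "is_projection p" and "is_projection q" and "invertible_up_to a p q"
  shows "invertible_up_to (a\<^sup>\<star>) q p"
proof -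
  have pq: "(1 - p)\<^sup>\<star> = 1 - p" "(1 - q)\<^sup>\<star> = 1 - q"
    using assms(1,2) by (simp_all add: is_projection_def star_diff)
  obtain b where b: "b = (1 - p) * b * (1 - q)" "(1 - q) * a * (1 - p) * b = 1 - q"
      "b * ((1 - q) * a * (1 - p)) = 1 - p"
    using assms(3) by (auto simp: invertible_up_to_def Let_def)
  have "b\<^sup>\<star> = (1 - q) * b\<^sup>\<star> * (1 - p)"
    using arg_cong[OF b(1), of star] by (simp only: star_mult pq mult.assoc)
  moreover have "(1 - p) * a\<^sup>\<star> * (1 - q) * b\<^sup>\<star> = 1 - p"
    using arg_cong[OF b(3), of star] by (simp only: star_mult pq mult.assoc)
  moreover have "b\<^sup>\<star> * ((1 - p) * a\<^sup>\<star> * (1 - q)) = 1 - q"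
    using arg_cong[OF b(2), of star] by (simp only: star_mult pq mult.assoc)
  ultimately show ?thesis
    unfolding invertible_up_to_def Let_def by blast
qed

lemma lower_semi_fredholm_iff_upper_star:
  "lower_semi_fredholm F a \<longleftrightarrow> upper_semi_fredholm F (a\<^sup>\<star>)"
  unfolding lower_semi_fredholm_def upper_semi_fredholm_def
  using invertible_up_to_star by (metis star_star)

lemma right_invertible_up_to_iff_left_star:
  assumes "is_projection q"
  shows "right_invertible_up_to a q \<longleftrightarrow> left_invertible_up_to (a\<^sup>\<star>) q"
proof -
  have q: "(1 - q)\<^sup>\<star> = 1 - q"
    using assms by (simp add: is_projection_def star_diff)
  have adj: "((1 - q) * a * b)\<^sup>\<star> = b\<^sup>\<star> * a\<^sup>\<star> * (1 - q)" for b
    by (simp add: star_mult q mult.assoc)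
  have "(1 - q) * a * b = 1 - q \<longleftrightarrow> b\<^sup>\<star> * a\<^sup>\<star> * (1 - q) = 1 - q" for b
    by (metis adj q star_star)
  then show ?thesis
    \<comment> \<open>Every element is an adjoint, so \<open>b\<close> and its adjoint range over
      the same elements.\<close>
    unfolding right_invertible_up_to_def left_invertible_up_to_def by (metis star_star)
qed

theorem lemma3p10:
  fixes F :: "'a::cstar_algebra set" and a :: 'a
  assumes "finite_type_ideal TYPE('i) F"
  shows "(upper_semi_fredholm F a \<longleftrightarrow>
            (\<exists>p\<in>F. is_projection p \<and> left_invertible_up_to a p)) \<and>
         (lower_semi_fredholm F a \<longleftrightarrow>
            (\<exists>q\<in>F. is_projection q \<and> right_invertible_up_to a q))"
  using right_invertible_up_to_iff_left_star
  by (auto simp: lower_semi_fredholm_iff_upper_star upper_semi_fredholm_iff_left_invertible)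

end
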